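(* Let $\mathcal{Q}$ be a small quantaloid and let $\mathcal{H}$ be the Hausdorff doctrine on $\mathrm{Cat}(\mathcal{Q})$, i.e. the KZ-doctrine associated with the saturated class of conical presheaves, and let $\mathcal{H}'$ be its extension to distributors. Let $\mathbb{A},\mathbb{B}$ be $\mathcal{Q}$-categories and $X,Y\in\mathcal{Q}_0$. (a) If $A\subseteq\mathbb{A}_X$, $A'\subseteq\mathbb{A}_Y$, $\phi=\bigvee_{a\in A}\mathbb{A}(-,a)$ and $\phi'=\bigvee_{a'\in A'}\mathbb{A}(-,a')$, then $$\mathcal{H}(\mathbb{A})(\phi',\phi)=\bigwedge_{a'\in A'}\bigvee_{a\in A}\mathbb{A}(a',a).$$ (b) If $F:\mathbb{A}\to\mathbb{B}$ is a functor and $\phi=\bigvee_{a\in A}\mathbb{A}(-,a)$ with $A\subseteq\mathbb{A}_X$, then $$\mathcal{H}(F)(\phi)=\bigvee_{a\in A}\mathbb{B}(-,Fa).$$ (c) If $\Phi:\mathbb{A}\to\mathbb{B}$ is a distributor, $\phi=\bigvee_{a\in A}\mathbb{A}(-,a)$ with $A\subseteq\mathbb{A}_X$ and $\psi=\bigvee_{b\in B}\mathbb{B}(-,b)$ with $B\subseteq\mathbb{B}_Y$, then $$\mathcal{H}'(\Phi)(\psi,\phi)=\bigwedge_{b\in B}\bigvee_{a\in A}\Phi(b,a).$$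
   Context: A quantaloid is a category whose hom-sets are complete lattices and whose composition preserves arbitrary suprema in each variable. $\mathcal{Q}$ is a small quantaloid, with set of objects $\mathcal{Q}_0$. A $\mathcal{Q}$-category $\mathbb{A}$ is a set $\mathbb{A}_0$ with a type function $t:\mathbb{A}_0\to\mathcal{Q}_0$ and $\mathcal{Q}$-arrows $\mathbb{A}(a',a):ta\to ta'$ with $1_{ta}\le\mathbb{A}(a,a)$ and $\mathbb{A}(a'',a')\circ\mathbb{A}(a',a)\le\mathbb{A}(a'',a)$. $\mathbb{A}_X$ denotes the set of objects of type $X$. A functor $F:\mathbb{A}\to\mathbb{B}$ is a type-preserving map with $\mathbb{A}(a',a)\le\mathbb{B}(Fa',Fa)$. A distributor $\Phi$ from $\mathbb{A}$ to $\mathbb{B}$ is a matrix of arrows $\Phi(b,a):ta\to tb$ with $\Phi(b,a')\circ\mathbb{A}(a',a)\le\Phi(b,a)$ and $\mathbb{B}(b,b')\circ\Phi(b',a)\le\Phi(b,a)$. Composition is $(\Psi\otimes\Phi)(c,a)=\bigvee_b\Psi(c,b)\circ\Phi(b,a)$; distributors are ordered elementwise, with elementwise suprema, and form a (large) quantaloid $\mathrm{Dist}(\mathcal{Q})$. For $\Phi:\mathbb{A}\to\mathbb{C}$ and $\Psi:\mathbb{B}\to\mathbb{C}$ in $\mathrm{Dist}(\mathcal{Q})$, the lifting $[\Psi,\Phi]:\mathbb{A}\to\mathbb{B}$ is the largest distributor with $\Psi\otimes[\Psi,\Phi]\le\Phi$. A functor $F:\mathbb{A}\to\mathbb{B}$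 gives a distributor $\mathbb{B}(-,F-):\mathbb{A}\to\mathbb{B}$. $*_X$ is the one-object $\mathcal{Q}$-category with object of type $X$ and hom-arrow $1_X$. A presheaf on $\mathbb{A}$ is a distributor $\phi:*_X\to\mathbb{A}$, $X\in\mathcal{Q}_0$. Presheaves on $\mathbb{A}$ are the objects of the $\mathcal{Q}$-category $\mathcal{P}(\mathbb{A})$, with $t\phi=X$ and $\mathcal{P}(\mathbb{A})(\psi,\phi)=$ the single element of $[\psi,\phi]$. A presheaf $\phi:*_X\to\mathbb{A}$ is conical if $\phi=\bigvee_{i\in I}\mathbb{A}(-,a_i)$ for some family $(a_i)_{i\in I}$ in $\mathbb{A}_X$. $\mathcal{H}(\mathbb{A})$ is the full subcategory of $\mathcal{P}(\mathbb{A})$ on the conical presheaves on $\mathbb{A}$. For a functor $F:\mathbb{A}\to\mathbb{B}$, $\mathcal{H}(F):\mathcal{H}(\mathbb{A})\to\mathcal{H}(\mathbb{B})$ is $\phi\mapsto\mathbb{B}(-,F-)\otimes\phi$. For a distributor $\Phi:\mathbb{A}\to\mathbb{B}$, $\mathcal{H}'(\Phi):\mathcal{H}(\mathbb{A})\to\mathcal{H}(\mathbb{B})$ is the distributor with elements $\mathcal{H}'(\Phi)(\psi,\phi)=\mathcal{P}(\mathbb{B})(\psi,\Phi\otimes\phi)$. The infima in the claim are taken in the relevant hom-lattice of $\mathcal{Q}$, namely $\mathcal{Q}(X,Y)$. *)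

theory Defs
  imports "HOL-Algebra.Complete_Lattice"
begin

section \<open>Quantaloids\<close>

text \<open>
  Hom-sets are complete lattices in the sense of \<^locale>\<open>complete_lattice\<close>.
  Arrows do not carry their domain and codomain, so composition takes them as arguments:
  for \<open>f : X \<rightarrow> Y\<close> and \<open>g : Y \<rightarrow> Z\<close>, the composite \<open>g \<circ> f\<close> is \<open>Cmp Q X Y Z g f\<close>.
  Nothing is assumed about any component outside \<open>Obj Q\<close> and the carriers of the hom-lattices.
\<close>

record ('o, 'm) quantaloid =
  Obj :: "'o set"
  Hom :: "'o \<Rightarrow> 'o \<Rightarrow> 'm gorder"
  Cmp :: "'o \<Rightarrow> 'o \<Rightarrow> 'o \<Rightarrow> 'm \<Rightarrow> 'm \<Rightarrow> 'm"
  Idt :: "'o \<Rightarrow> 'm"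

locale quantaloid =
  fixes Q :: "('o, 'm) quantaloid"
  assumes Hom_complete_lattice:
      "\<lbrakk>X \<in> Obj Q; Y \<in> Obj Q\<rbrakk> \<Longrightarrow> complete_lattice (Hom Q X Y)"
    and Idt_closed:
      "X \<in> Obj Q \<Longrightarrow> Idt Q X \<in> carrier (Hom Q X X)"
    and Cmp_closed:
      "\<lbrakk>X \<in> Obj Q; Y \<in> Obj Q; Z \<in> Obj Q;
        f \<in> carrier (Hom Q X Y); g \<in> carrier (Hom Q Y Z)\<rbrakk>
       \<Longrightarrow> Cmp Q X Y Z g f \<in> carrier (Hom Q X Z)"
    and Cmp_assoc:
      "\<lbrakk>W \<in> Obj Q; X \<in> Obj Q; Y \<in> Obj Q; Z \<in> Obj Q;
        f \<in> carrier (Hom Q W X); g \<in> carrier (Hom Q X Y); h \<in> carrier (Hom Q Y Z)\<rbrakk>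
       \<Longrightarrow> Cmp Q W Y Z h (Cmp Q W X Y g f) = Cmp Q W X Z (Cmp Q X Y Z h g) f"
    and Cmp_Idt_right:
      "\<lbrakk>X \<in> Obj Q; Y \<in> Obj Q; f \<in> carrier (Hom Q X Y)\<rbrakk>
       \<Longrightarrow> Cmp Q X X Y f (Idt Q X) = f"
    and Cmp_Idt_left:
      "\<lbrakk>X \<in> Obj Q; Y \<in> Obj Q; f \<in> carrier (Hom Q X Y)\<rbrakk>
       \<Longrightarrow> Cmp Q X Y Y (Idt Q Y) f = f"
    and Cmp_sup_left:
      "\<lbrakk>X \<in> Obj Q; Y \<in> Obj Q; Z \<in> Obj Q;
        f \<in> carrier (Hom Q X Y); G \<subseteq> carrier (Hom Q Y Z)\<rbrakk>
       \<Longrightarrow> Cmp Q X Y Z (\<Squnion>\<^bsub>Hom Q Y Z\<^esub> G) f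
           = \<Squnion>\<^bsub>Hom Q X Z\<^esub> ((\<lambda>g. Cmp Q X Y Z g f) ` G)"
    and Cmp_sup_right:
      "\<lbrakk>X \<in> Obj Q; Y \<in> Obj Q; Z \<in> Obj Q;
        F \<subseteq> carrier (Hom Q X Y); g \<in> carrier (Hom Q Y Z)\<rbrakk>
       \<Longrightarrow> Cmp Q X Y Z g (\<Squnion>\<^bsub>Hom Q X Y\<^esub> F)
           = \<Squnion>\<^bsub>Hom Q X Z\<^esub> ((\<lambda>f. Cmp Q X Y Z g f) ` F)"


section \<open>Categories, functors and distributors enriched in a quantaloid\<close>

text \<open>\<open>hm A (a', a)\<close> is an arrow from \<open>ty A a\<close> to \<open>ty A a'\<close>.\<close>

record ('o, 'm, 'a) qcat =
  ob :: "'a set"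
  ty :: "'a \<Rightarrow> 'o"
  hm :: "'a \<times> 'a \<Rightarrow> 'm"

definition qcategory :: "('o, 'm) quantaloid \<Rightarrow> ('o, 'm, 'a) qcat \<Rightarrow> bool" where
  "qcategory Q A \<longleftrightarrow>
     (\<forall>a\<in>ob A. ty A a \<in> Obj Q) \<and>
     (\<forall>a'\<in>ob A. \<forall>a\<in>ob A. hm A (a', a) \<in> carrier (Hom Q (ty A a) (ty A a'))) \<and>
     (\<forall>a\<in>ob A. Idt Q (ty A a) \<sqsubseteq>\<^bsub>Hom Q (ty A a) (ty A a)\<^esub> hm A (a, a)) \<and>
     (\<forall>a''\<in>ob A. \<forall>a'\<in>ob A. \<forall>a\<in>ob A.
        Cmp Q (ty A a) (ty A a') (ty A a'') (hm A (a'', a')) (hm A (a', a))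
          \<sqsubseteq>\<^bsub>Hom Q (ty A a) (ty A a'')\<^esub> hm A (a'', a))"

definition ob_of_type :: "('o, 'm, 'a) qcat \<Rightarrow> 'o \<Rightarrow> 'a set" where
  "ob_of_type A X = {a \<in> ob A. ty A a = X}"

definition qfunctor ::
  "('o, 'm) quantaloid \<Rightarrow> ('o, 'm, 'a) qcat \<Rightarrow> ('o, 'm, 'b) qcat \<Rightarrow> ('a \<Rightarrow> 'b) \<Rightarrow> bool" where
  "qfunctor Q A B F \<longleftrightarrow>
     (\<forall>a\<in>ob A. F a \<in> ob B \<and> ty B (F a) = ty A a) \<and>
     (\<forall>a'\<in>ob A. \<forall>a\<in>ob A.
        hm A (a', a) \<sqsubseteq>\<^bsub>Hom Q (ty A a) (ty A a')\<^esub> hm B (F a', F a))"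

text \<open>
  A distributor from \<open>A\<close> to \<open>B\<close> is a matrix indexed by \<open>ob B \<times> ob A\<close>. It is represented by a
  function that is \<^const>\<open>undefined\<close> off this index set, so that equality of distributors
  is equality of matrices.
\<close>

definition distributor ::
  "('o, 'm) quantaloid \<Rightarrow> ('o, 'm, 'a) qcat \<Rightarrow> ('o, 'm, 'b) qcat \<Rightarrow> ('b \<times> 'a \<Rightarrow> 'm) \<Rightarrow> bool" where
  "distributor Q A B \<Phi> \<longleftrightarrow>
     \<Phi> \<in> (\<Pi>\<^sub>E (b, a) \<in> ob B \<times> ob A. carrier (Hom Q (ty A a) (ty B b))) \<and>
     (\<forall>b\<in>ob B. \<forall>a'\<in>ob A. \<forall>a\<in>ob A.
        Cmp Q (ty A a) (ty A a') (ty B b) (\<Phi> (b, a')) (hm A (a', a))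
          \<sqsubseteq>\<^bsub>Hom Q (ty A a) (ty B b)\<^esub> \<Phi> (b, a)) \<and>
     (\<forall>b\<in>ob B. \<forall>b'\<in>ob B. \<forall>a\<in>ob A.
        Cmp Q (ty A a) (ty B b') (ty B b) (hm B (b, b')) (\<Phi> (b', a))
          \<sqsubseteq>\<^bsub>Hom Q (ty A a) (ty B b)\<^esub> \<Phi> (b, a))"

text \<open>The hom-lattice of distributors from \<open>A\<close> to \<open>B\<close>, ordered elementwise.\<close>

definition Dist ::
  "('o, 'm) quantaloid \<Rightarrow> ('o, 'm, 'a) qcat \<Rightarrow> ('o, 'm, 'b) qcat \<Rightarrow> ('b \<times> 'a \<Rightarrow> 'm) gorder" where
  "Dist Q A B =
     \<lparr>carrier = {\<Phi>. distributor Q A B \<Phi>},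
      eq = (=),
      le = (\<lambda>\<Phi> \<Phi>'. \<forall>b\<in>ob B. \<forall>a\<in>ob A. \<Phi> (b, a) \<sqsubseteq>\<^bsub>Hom Q (ty A a) (ty B b)\<^esub> \<Phi>' (b, a))\<rparr>"

text \<open>The composite \<open>\<Psi> \<otimes> \<Phi>\<close> of \<open>\<Phi> : A \<rightarrow> B\<close> and \<open>\<Psi> : B \<rightarrow> C\<close>.\<close>

definition dist_comp ::
  "('o, 'm) quantaloid \<Rightarrow> ('o, 'm, 'a) qcat \<Rightarrow> ('o, 'm, 'b) qcat \<Rightarrow> ('o, 'm, 'c) qcat
     \<Rightarrow> ('c \<times> 'b \<Rightarrow> 'm) \<Rightarrow> ('b \<times> 'a \<Rightarrow> 'm) \<Rightarrow> ('c \<times> 'a \<Rightarrow> 'm)" where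
  "dist_comp Q A B C \<Psi> \<Phi> =
     (\<lambda>(c, a) \<in> ob C \<times> ob A.
        \<Squnion>\<^bsub>Hom Q (ty A a) (ty C c)\<^esub>
          ((\<lambda>b. Cmp Q (ty A a) (ty B b) (ty C c) (\<Psi> (c, b)) (\<Phi> (b, a))) ` ob B))"

text \<open>The lifting \<open>[\<Psi>, \<Phi>] : A \<rightarrow> B\<close> of \<open>\<Phi> : A \<rightarrow> C\<close> through \<open>\<Psi> : B \<rightarrow> C\<close>.\<close>

definition lifting ::
  "('o, 'm) quantaloid \<Rightarrow> ('o, 'm, 'a) qcat \<Rightarrow> ('o, 'm, 'b) qcat \<Rightarrow> ('o, 'm, 'c) qcat
     \<Rightarrow> ('c \<times> 'b \<Rightarrow> 'm) \<Rightarrow> ('c \<times> 'a \<Rightarrow> 'm) \<Rightarrow> ('b \<times> 'a \<Rightarrow> 'm)" where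
  "lifting Q A B C \<Psi> \<Phi> =
     (THE \<Theta>. greatest (Dist Q A B) \<Theta>
        {\<Theta>. distributor Q A B \<Theta> \<and> dist_comp Q A B C \<Psi> \<Theta> \<sqsubseteq>\<^bsub>Dist Q A C\<^esub> \<Phi>})"

text \<open>The distributor \<open>B(-, F-)\<close> of a functor \<open>F : A \<rightarrow> B\<close>.\<close>

definition graph_dist ::
  "('o, 'm, 'a) qcat \<Rightarrow> ('o, 'm, 'b) qcat \<Rightarrow> ('a \<Rightarrow> 'b) \<Rightarrow> ('b \<times> 'a \<Rightarrow> 'm)" where
  "graph_dist A B F = (\<lambda>(b, a) \<in> ob B \<times> ob A. hm B (b, F a))"


section \<open>Presheaves\<close>

definition star :: "('o, 'm) quantaloid \<Rightarrow> 'o \<Rightarrow> ('o, 'm, unit) qcat" where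
  "star Q X = \<lparr>ob = {()}, ty = (\<lambda>_. X), hm = (\<lambda>_. Idt Q X)\<rparr>"

text \<open>
  A presheaf \<open>\<phi> : star Q X \<rightarrow> A\<close> is represented by the pair \<open>(X, \<phi>)\<close>, since the matrix \<open>\<phi>\<close> alone
  does not determine its type \<open>X\<close> (for instance when \<open>A\<close> is empty).
\<close>

type_synonym ('o, 'm, 'a) presheaf = "'o \<times> ('a \<times> unit \<Rightarrow> 'm)"

definition Psh ::
  "('o, 'm) quantaloid \<Rightarrow> ('o, 'm, 'a) qcat \<Rightarrow> ('o, 'm, ('o, 'm, 'a) presheaf) qcat" where
  "Psh Q A =
     \<lparr>ob = {(X, \<phi>). X \<in> Obj Q \<and> distributor Q (star Q X) A \<phi>},
      ty = fst,
      hm = (\<lambda>((Y, \<psi>), (X, \<phi>)). lifting Q (star Q X) (star Q Y) A \<psi> \<phi> ((), ()))\<rparr>"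

text \<open>The representable presheaf \<open>A(-, a) : star Q (ty A a) \<rightarrow> A\<close>, as a distributor.\<close>

definition repr :: "('o, 'm, 'a) qcat \<Rightarrow> 'a \<Rightarrow> ('a \<times> unit \<Rightarrow> 'm)" where
  "repr A a = (\<lambda>(a', _) \<in> ob A \<times> {()}. hm A (a', a))"

text \<open>
  The supremum of the representables \<open>A(-, a)\<close>, \<open>a \<in> S\<close>, where \<open>S\<close> consists of objects of type \<open>X\<close>.
  It is taken in the ordered set of distributors from \<open>star Q X\<close> to \<open>A\<close>; for empty \<open>S\<close> it depends
  on \<open>X\<close>.
\<close>

definition sup_repr ::
  "('o, 'm) quantaloid \<Rightarrow> ('o, 'm, 'a) qcat \<Rightarrow> 'o \<Rightarrow> 'a set \<Rightarrow> ('o, 'm, 'a) presheaf" where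
  "sup_repr Q A X S = (X, \<Squnion>\<^bsub>Dist Q (star Q X) A\<^esub> (repr A ` S))"

text \<open>A family of objects of type \<open>X\<close> enters the supremum only through its set of members.\<close>

definition conical ::
  "('o, 'm) quantaloid \<Rightarrow> ('o, 'm, 'a) qcat \<Rightarrow> ('o, 'm, 'a) presheaf \<Rightarrow> bool" where
  "conical Q A p \<longleftrightarrow> (\<exists>S \<subseteq> ob_of_type A (fst p). p = sup_repr Q A (fst p) S)"


section \<open>The Hausdorff doctrine\<close>

definition Haus ::
  "('o, 'm) quantaloid \<Rightarrow> ('o, 'm, 'a) qcat \<Rightarrow> ('o, 'm, ('o, 'm, 'a) presheaf) qcat" where
  "Haus Q A = (Psh Q A)\<lparr>ob := {p \<in> ob (Psh Q A). conical Q A p}\<rparr>"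

definition Haus_map ::
  "('o, 'm) quantaloid \<Rightarrow> ('o, 'm, 'a) qcat \<Rightarrow> ('o, 'm, 'b) qcat \<Rightarrow> ('a \<Rightarrow> 'b)
     \<Rightarrow> (('o, 'm, 'a) presheaf \<Rightarrow> ('o, 'm, 'b) presheaf)" where
  "Haus_map Q A B F =
     (\<lambda>(X, \<phi>) \<in> ob (Haus Q A). (X, dist_comp Q (star Q X) A B (graph_dist A B F) \<phi>))"

definition Haus_dist ::
  "('o, 'm) quantaloid \<Rightarrow> ('o, 'm, 'a) qcat \<Rightarrow> ('o, 'm, 'b) qcat \<Rightarrow> ('b \<times> 'a \<Rightarrow> 'm)
     \<Rightarrow> (('o, 'm, 'b) presheaf \<times> ('o, 'm, 'a) presheaf \<Rightarrow> 'm)" where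
  "Haus_dist Q A B \<Phi> =
     (\<lambda>(q, (X, \<phi>)) \<in> ob (Haus Q B) \<times> ob (Haus Q A).
        hm (Psh Q B) (q, (X, dist_comp Q (star Q X) A B \<Phi> \<phi>)))"

end

theory Submission
  imports Defs
begin

text \<open>
  Composition preserves suprema, so for \<open>\<psi> = \<Squnion>\<^bsub>b \<in> S\<^esub> \<B>(-, b)\<close> an arrow \<open>f : X \<rightarrow> Y\<close> satisfies
  \<open>\<psi> \<otimes> f \<le> \<phi>\<close> iff \<open>\<B>(c, b) \<circ> f \<le> \<phi>(c)\<close> for all \<open>c\<close> and all \<open>b \<in> S\<close>. By the Yoneda argument this
  says \<open>f \<le> \<phi>(b)\<close> for all \<open>b \<in> S\<close>; hence \<open>[\<psi>, \<phi>] = \<Sqinter>\<^bsub>b \<in> S\<^esub> \<phi>(b)\<close>. In the same way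
  \<open>\<Phi> \<otimes> \<Squnion>\<^bsub>a \<in> S\<^esub> \<A>(-, a) = \<Squnion>\<^bsub>a \<in> S\<^esub> \<Phi>(-, a)\<close>. All three claims are instances of these two formulas.
\<close>

section \<open>Hom-lattices\<close>

context quantaloid
begin

lemma Hom_refl:
  assumes "X \<in> Obj Q" "Y \<in> Obj Q" "f \<in> carrier (Hom Q X Y)"
  shows "f \<sqsubseteq>\<^bsub>Hom Q X Y\<^esub> f"
proof -
  interpret H: complete_lattice "Hom Q X Y" using assms by (intro Hom_complete_lattice)
  show ?thesis using assms by simp
qed

lemma Hom_trans:
  assumes "X \<in> Obj Q" "Y \<in> Obj Q"
    and "f \<sqsubseteq>\<^bsub>Hom Q X Y\<^esub> g" "g \<sqsubseteq>\<^bsub>Hom Q X Y\<^esub> h"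
    and "f \<in> carrier (Hom Q X Y)" "g \<in> carrier (Hom Q X Y)" "h \<in> carrier (Hom Q X Y)"
  shows "f \<sqsubseteq>\<^bsub>Hom Q X Y\<^esub> h"
proof -
  interpret H: complete_lattice "Hom Q X Y" using assms by (intro Hom_complete_lattice)
  show ?thesis using assms by (blast intro: H.le_trans)
qed

lemma Hom_antisym:
  assumes "X \<in> Obj Q" "Y \<in> Obj Q"
    and "f \<sqsubseteq>\<^bsub>Hom Q X Y\<^esub> g" "g \<sqsubseteq>\<^bsub>Hom Q X Y\<^esub> f"
    and "f \<in> carrier (Hom Q X Y)" "g \<in> carrier (Hom Q X Y)"
  shows "f = g"
proof -
  interpret H: complete_lattice "Hom Q X Y" using assms by (intro Hom_complete_lattice)
  show ?thesis using assms by (blast intro: H.le_antisym)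
qed

lemma Hom_sup_closed:
  assumes "X \<in> Obj Q" "Y \<in> Obj Q" "G \<subseteq> carrier (Hom Q X Y)"
  shows "\<Squnion>\<^bsub>Hom Q X Y\<^esub> G \<in> carrier (Hom Q X Y)"
proof -
  interpret H: complete_lattice "Hom Q X Y" using assms by (intro Hom_complete_lattice)
  show ?thesis using assms by simp
qed

lemma Hom_inf_closed:
  assumes "X \<in> Obj Q" "Y \<in> Obj Q" "G \<subseteq> carrier (Hom Q X Y)"
  shows "\<Sqinter>\<^bsub>Hom Q X Y\<^esub> G \<in> carrier (Hom Q X Y)"
proof -
  interpret H: complete_lattice "Hom Q X Y" using assms by (intro Hom_complete_lattice)
  show ?thesis using assms by simp
qed

lemma Hom_sup_singleton:
  assumes "X \<in> Obj Q" "Y \<in> Obj Q" "f \<in> carrier (Hom Q X Y)"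
  shows "\<Squnion>\<^bsub>Hom Q X Y\<^esub> {f} = f"
proof -
  interpret H: complete_lattice "Hom Q X Y" using assms by (intro Hom_complete_lattice)
  show ?thesis using assms by simp
qed

lemma Hom_sup_upper:
  assumes "X \<in> Obj Q" "Y \<in> Obj Q" "G \<subseteq> carrier (Hom Q X Y)" "g \<in> G"
  shows "g \<sqsubseteq>\<^bsub>Hom Q X Y\<^esub> \<Squnion>\<^bsub>Hom Q X Y\<^esub> G"
proof -
  interpret H: complete_lattice "Hom Q X Y" using assms by (intro Hom_complete_lattice)
  show ?thesis using assms by (intro H.sup_upper)
qed

lemma Hom_sup_le_iff:
  assumes "X \<in> Obj Q" "Y \<in> Obj Q" "G \<subseteq> carrier (Hom Q X Y)" "f \<in> carrier (Hom Q X Y)"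
  shows "\<Squnion>\<^bsub>Hom Q X Y\<^esub> G \<sqsubseteq>\<^bsub>Hom Q X Y\<^esub> f \<longleftrightarrow> (\<forall>g\<in>G. g \<sqsubseteq>\<^bsub>Hom Q X Y\<^esub> f)"
proof -
  interpret H: complete_lattice "Hom Q X Y" using assms by (intro Hom_complete_lattice)
  show ?thesis
    using assms H.sup_least[of G f] H.sup_upper[of G] H.sup_closed[of G]
    by (meson H.le_trans subsetD)
qed

lemma Hom_le_inf_iff:
  assumes "X \<in> Obj Q" "Y \<in> Obj Q" "G \<subseteq> carrier (Hom Q X Y)" "f \<in> carrier (Hom Q X Y)"
  shows "f \<sqsubseteq>\<^bsub>Hom Q X Y\<^esub> \<Sqinter>\<^bsub>Hom Q X Y\<^esub> G \<longleftrightarrow> (\<forall>g\<in>G. f \<sqsubseteq>\<^bsub>Hom Q X Y\<^esub> g)"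
proof -
  interpret H: complete_lattice "Hom Q X Y" using assms by (intro Hom_complete_lattice)
  show ?thesis
    using assms H.inf_greatest[of G f] H.inf_lower[of G] H.inf_closed[of G]
    by (meson H.le_trans subsetD)
qed

text \<open>Rewrites an inequality as an equation between suprema, the form in which the axioms on
  composition can be applied to it.\<close>

lemma Hom_sup_pair_eq:
  assumes "X \<in> Obj Q" "Y \<in> Obj Q" "f \<in> carrier (Hom Q X Y)" "g \<in> carrier (Hom Q X Y)"
    and "f \<sqsubseteq>\<^bsub>Hom Q X Y\<^esub> g"
  shows "\<Squnion>\<^bsub>Hom Q X Y\<^esub> {f, g} = g"
  using assms Hom_sup_le_iff[of X Y "{f, g}" g] Hom_sup_upper[of X Y "{f, g}" g]
    Hom_sup_closed[of X Y "{f, g}"] Hom_refl[of X Y g]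
  by (intro Hom_antisym) auto

text \<open>Monotonicity is not an axiom but follows from preservation of suprema: if
  \<open>g\<close> lies below \<open>h\<close>, the supremum of \<open>{g, h}\<close> is
  \<open>h\<close>, so composing with \<open>f\<close> makes \<open>h \<circ> f\<close> the supremum
  of \<open>g \<circ> f\<close> and \<open>h \<circ> f\<close>. The other variable is treated in the
  same way.\<close>

lemma Cmp_mono_left:
  assumes "X \<in> Obj Q" "Y \<in> Obj Q" "Z \<in> Obj Q" "f \<in> carrier (Hom Q X Y)"
    and "g \<in> carrier (Hom Q Y Z)" "h \<in> carrier (Hom Q Y Z)" "g \<sqsubseteq>\<^bsub>Hom Q Y Z\<^esub> h"
  shows "Cmp Q X Y Z g f \<sqsubseteq>\<^bsub>Hom Q X Z\<^esub> Cmp Q X Y Z h f"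
proof -
  have "Cmp Q X Y Z h f = \<Squnion>\<^bsub>Hom Q X Z\<^esub> {Cmp Q X Y Z g f, Cmp Q X Y Z h f}"
    using Cmp_sup_left[of X Y Z f "{g, h}"] Hom_sup_pair_eq[of Y Z g h] assms by simp
  then show ?thesis
    using Hom_sup_upper[of X Z "{Cmp Q X Y Z g f, Cmp Q X Y Z h f}"] assms
    by (metis Cmp_closed empty_subsetI insertI1 insert_subset)
qed

lemma Cmp_mono_right:
  assumes "X \<in> Obj Q" "Y \<in> Obj Q" "Z \<in> Obj Q" "h \<in> carrier (Hom Q Y Z)"
    and "f \<in> carrier (Hom Q X Y)" "g \<in> carrier (Hom Q X Y)" "f \<sqsubseteq>\<^bsub>Hom Q X Y\<^esub> g"
  shows "Cmp Q X Y Z h f \<sqsubseteq>\<^bsub>Hom Q X Z\<^esub> Cmp Q X Y Z h g"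
proof -
  have "Cmp Q X Y Z h g = \<Squnion>\<^bsub>Hom Q X Z\<^esub> {Cmp Q X Y Z h f, Cmp Q X Y Z h g}"
    using Cmp_sup_right[of X Y Z "{f, g}" h] Hom_sup_pair_eq[of X Y f g] assms by simp
  then show ?thesis
    using Hom_sup_upper[of X Z "{Cmp Q X Y Z h f, Cmp Q X Y Z h g}"] assms
    by (metis Cmp_closed empty_subsetI insertI1 insert_subset)
qed

end


section \<open>Suprema of columns\<close>

lemma qcategoryD:
  assumes "qcategory Q A"
  shows "a \<in> ob A \<Longrightarrow> ty A a \<in> Obj Q"
    and "a' \<in> ob A \<Longrightarrow> a \<in> ob A \<Longrightarrow> hm A (a', a) \<in> carrier (Hom Q (ty A a) (ty A a'))"
    and "a \<in> ob A \<Longrightarrow> Idt Q (ty A a) \<sqsubseteq>\<^bsub>Hom Q (ty A a) (ty A a)\<^esub> hm A (a, a)"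
    and "a'' \<in> ob A \<Longrightarrow> a' \<in> ob A \<Longrightarrow> a \<in> ob A \<Longrightarrow>
      Cmp Q (ty A a) (ty A a') (ty A a'') (hm A (a'', a')) (hm A (a', a))
        \<sqsubseteq>\<^bsub>Hom Q (ty A a) (ty A a'')\<^esub> hm A (a'', a)"
  using assms unfolding qcategory_def by blast+

lemma distributorD:
  assumes "distributor Q A B \<Phi>"
  shows "b \<in> ob B \<Longrightarrow> a \<in> ob A \<Longrightarrow> \<Phi> (b, a) \<in> carrier (Hom Q (ty A a) (ty B b))"
    and "b \<in> ob B \<Longrightarrow> a' \<in> ob A \<Longrightarrow> a \<in> ob A \<Longrightarrow>
      Cmp Q (ty A a) (ty A a') (ty B b) (\<Phi> (b, a')) (hm A (a', a))
        \<sqsubseteq>\<^bsub>Hom Q (ty A a) (ty B b)\<^esub> \<Phi> (b, a)"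
    and "b \<in> ob B \<Longrightarrow> b' \<in> ob B \<Longrightarrow> a \<in> ob A \<Longrightarrow>
      Cmp Q (ty A a) (ty B b') (ty B b) (hm B (b, b')) (\<Phi> (b', a))
        \<sqsubseteq>\<^bsub>Hom Q (ty A a) (ty B b)\<^esub> \<Phi> (b, a)"
  using assms unfolding distributor_def by (auto simp: PiE_iff)

lemma star_simps [simp]: "ob (star Q X) = {()}" "ty (star Q X) u = X" "hm (star Q X) v = Idt Q X"
  by (simp_all add: star_def)

lemma (in quantaloid) qcategory_star:
  assumes "X \<in> Obj Q"
  shows "qcategory Q (star Q X)"
  using assms Idt_closed[of X] Cmp_Idt_left[of X X "Idt Q X"] Hom_refl[of X X "Idt Q X"]
  by (simp add: qcategory_def)

text \<open>The right action of the one-object category is composition with an identity, so its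
  inequality holds by reflexivity and only the left action of \<open>B\<close> remains to be
  checked.\<close>

lemma (in quantaloid) distributor_star_iff:
  assumes "X \<in> Obj Q" "qcategory Q B"
  shows "distributor Q (star Q X) B \<phi> \<longleftrightarrow>
    \<phi> \<in> extensional (ob B \<times> {()}) \<and>
    (\<forall>b\<in>ob B. \<phi> (b, ()) \<in> carrier (Hom Q X (ty B b))) \<and>
    (\<forall>b\<in>ob B. \<forall>b'\<in>ob B. Cmp Q X (ty B b') (ty B b) (hm B (b, b')) (\<phi> (b', ()))
      \<sqsubseteq>\<^bsub>Hom Q X (ty B b)\<^esub> \<phi> (b, ()))"
  using assms qcategoryD(1)[OF assms(2)]
  by (auto simp: distributor_def PiE_iff Cmp_Idt_right Hom_refl)

text \<open>Elementwise antisymmetry gives equal entries, and extensionality off the index set turns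
  this into equality of functions. This is what makes suprema in \<open>Dist\<close> unique.\<close>

lemma Dist_antisym:
  assumes "quantaloid Q" "qcategory Q A" "qcategory Q B"
    and "distributor Q A B \<Phi>" "distributor Q A B \<Psi>"
    and "\<Phi> \<sqsubseteq>\<^bsub>Dist Q A B\<^esub> \<Psi>" "\<Psi> \<sqsubseteq>\<^bsub>Dist Q A B\<^esub> \<Phi>"
  shows "\<Phi> = \<Psi>"
proof (rule extensionalityI)
  show "\<Phi> \<in> extensional (ob B \<times> ob A)" "\<Psi> \<in> extensional (ob B \<times> ob A)"
    using assms(4,5) by (auto simp: distributor_def PiE_iff)
  fix p assume "p \<in> ob B \<times> ob A"
  then obtain b a where p: "p = (b, a)" and ab: "a \<in> ob A" "b \<in> ob B" by auto
  show "\<Phi> p = \<Psi> p"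
    unfolding p
    using assms(6,7) ab distributorD(1)[OF assms(4)] distributorD(1)[OF assms(5)]
      qcategoryD(1)[OF assms(2)] qcategoryD(1)[OF assms(3)]
    by (intro quantaloid.Hom_antisym[OF assms(1)]) (auto simp: Dist_def)
qed

text \<open>The elementwise join of the columns of \<open>\<Phi>\<close> indexed by
  \<open>S\<close>. With \<open>hm A\<close> as matrix it is a conical presheaf \<phi>; with a
  distributor \<Phi> it is the composite of \<Phi> with \<phi>. The type \<open>X\<close> is an
  argument because an empty \<open>S\<close> does not determine it.\<close>

definition col_sup ::
  "('o, 'm) quantaloid \<Rightarrow> 'o \<Rightarrow> ('o, 'm, 'b) qcat \<Rightarrow> ('b \<times> 'i \<Rightarrow> 'm) \<Rightarrow> 'i set \<Rightarrow> ('b \<times> unit \<Rightarrow> 'm)"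
  where "col_sup Q X B \<Phi> S =
    (\<lambda>(b, _) \<in> ob B \<times> {()}. \<Squnion>\<^bsub>Hom Q X (ty B b)\<^esub> ((\<lambda>s. \<Phi> (b, s)) ` S))"

lemma col_sup_apply:
  "b \<in> ob B \<Longrightarrow> col_sup Q X B \<Phi> S (b, ()) = \<Squnion>\<^bsub>Hom Q X (ty B b)\<^esub> ((\<lambda>s. \<Phi> (b, s)) ` S)"
  by (simp add: col_sup_def)

context quantaloid
begin

text \<open>Composition with \<open>hm B (b, b')\<close> preserves suprema, so the left action can
  be checked one column at a time. The matrix is arbitrary so that the result covers both
  distributors and hom-matrices.\<close>

lemma distributor_col_sup:
  assumes X: "X \<in> Obj Q" and B: "qcategory Q B"
    and closed: "\<And>b s. b \<in> ob B \<Longrightarrow> s \<in> S \<Longrightarrow> \<Phi> (b, s) \<in> carrier (Hom Q X (ty B b))"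
    and act: "\<And>b b' s. b \<in> ob B \<Longrightarrow> b' \<in> ob B \<Longrightarrow> s \<in> S \<Longrightarrow>
      Cmp Q X (ty B b') (ty B b) (hm B (b, b')) (\<Phi> (b', s)) \<sqsubseteq>\<^bsub>Hom Q X (ty B b)\<^esub> \<Phi> (b, s)"
  shows "distributor Q (star Q X) B (col_sup Q X B \<Phi> S)"
  unfolding distributor_star_iff[OF X B]
proof (intro conjI ballI)
  show "col_sup Q X B \<Phi> S \<in> extensional (ob B \<times> {()})"
    by (simp add: col_sup_def)
  fix b assume b: "b \<in> ob B"
  note tyb = qcategoryD(1)[OF B b]
  have sub: "(\<lambda>s. \<Phi> (b, s)) ` S \<subseteq> carrier (Hom Q X (ty B b))" if "b \<in> ob B" for b
    using closed that by blast
  show cl: "col_sup Q X B \<Phi> S (b, ()) \<in> carrier (Hom Q X (ty B b))"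
    using b X tyb sub by (simp add: col_sup_apply Hom_sup_closed)
  fix b' assume b': "b' \<in> ob B"
  note tyb' = qcategoryD(1)[OF B b']
  have "Cmp Q X (ty B b') (ty B b) (hm B (b, b')) (\<Phi> (b', s))
      \<sqsubseteq>\<^bsub>Hom Q X (ty B b)\<^esub> col_sup Q X B \<Phi> S (b, ())" if s: "s \<in> S" for s
  proof (rule Hom_trans[OF X tyb act[OF b b' s]])
    show "\<Phi> (b, s) \<sqsubseteq>\<^bsub>Hom Q X (ty B b)\<^esub> col_sup Q X B \<Phi> S (b, ())"
      using b X tyb sub s by (auto simp: col_sup_apply intro!: Hom_sup_upper)
  qed (use X tyb tyb' b b' s closed cl qcategoryD(2)[OF B b b'] in \<open>auto intro: Cmp_closed\<close>)
  then show "Cmp Q X (ty B b') (ty B b) (hm B (b, b')) (col_sup Q X B \<Phi> S (b', ()))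
      \<sqsubseteq>\<^bsub>Hom Q X (ty B b)\<^esub> col_sup Q X B \<Phi> S (b, ())"
    using X tyb tyb' b b' closed cl qcategoryD(2)[OF B b b'] sub
    by (simp add: col_sup_apply[OF b'] Cmp_sup_right image_image)
      (subst Hom_sup_le_iff, auto intro: Cmp_closed)
qed

lemma distributor_col_sup_distributor:
  assumes "X \<in> Obj Q" "qcategory Q B" "distributor Q A B \<Phi>" "S \<subseteq> ob_of_type A X"
  shows "distributor Q (star Q X) B (col_sup Q X B \<Phi> S)"
  using assms(1,2)
proof (rule distributor_col_sup)
  fix b s assume "b \<in> ob B" "s \<in> S"
  then show "\<Phi> (b, s) \<in> carrier (Hom Q X (ty B b))"
    using distributorD(1)[OF assms(3), of b s] assms(4) by (auto simp: ob_of_type_def)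
next
  fix b b' s assume "b \<in> ob B" "b' \<in> ob B" "s \<in> S"
  then show "Cmp Q X (ty B b') (ty B b) (hm B (b, b')) (\<Phi> (b', s)) \<sqsubseteq>\<^bsub>Hom Q X (ty B b)\<^esub> \<Phi> (b, s)"
    using distributorD(3)[OF assms(3), of b b' s] assms(4) by (auto simp: ob_of_type_def)
qed

text \<open>Proved separately from the case of a distributor: \<open>hm A\<close> may take any
  values off the objects of \<open>A\<close>, so it need not be extensional as
  \<open>distributor\<close> demands. The left action here is the composition law of
  \<open>A\<close>.\<close>

lemma distributor_col_sup_hm:
  assumes "X \<in> Obj Q" "qcategory Q A" "S \<subseteq> ob_of_type A X"
  shows "distributor Q (star Q X) A (col_sup Q X A (hm A) S)"
  using assms(1,2)
proof (rule distributor_col_sup)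
  fix b s assume "b \<in> ob A" "s \<in> S"
  then show "hm A (b, s) \<in> carrier (Hom Q X (ty A b))"
    using qcategoryD(2)[OF assms(2), of b s] assms(3) by (auto simp: ob_of_type_def)
next
  fix b b' s assume "b \<in> ob A" "b' \<in> ob A" "s \<in> S"
  then show "Cmp Q X (ty A b') (ty A b) (hm A (b, b')) (hm A (b', s))
      \<sqsubseteq>\<^bsub>Hom Q X (ty A b)\<^esub> hm A (b, s)"
    using qcategoryD(4)[OF assms(2), of b b' s] assms(3) by (auto simp: ob_of_type_def)
qed

section \<open>Conical presheaves as column suprema\<close>

lemma distributor_repr:
  assumes "qcategory Q A" "a \<in> ob A"
  shows "distributor Q (star Q (ty A a)) A (repr A a)"
  unfolding distributor_star_iff[OF qcategoryD(1)[OF assms] assms(1)]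
  using qcategoryD(2,4)[OF assms(1)] assms(2) by (auto simp: repr_def)

text \<open>The order on presheaves is elementwise and the elementwise join of representables is
  again a presheaf, so it is their least upper bound. From here on conical presheaves are computed
  entry by entry.\<close>

lemma sup_repr_eq_col_sup:
  assumes X: "X \<in> Obj Q" and A: "qcategory Q A" and S: "S \<subseteq> ob_of_type A X"
  shows "sup_repr Q A X S = (X, col_sup Q X A (hm A) S)"
proof -
  let ?D = "Dist Q (star Q X) A" and ?c = "col_sup Q X A (hm A) S"
  note c = distributor_col_sup_hm[OF X A S]
  have S': "a \<in> ob A" "ty A a = X" if "a \<in> S" for a
    using S that by (auto simp: ob_of_type_def)
  have reprs: "repr A ` S \<subseteq> carrier ?D"
    using S' distributor_repr[OF A] by (fastforce simp: Dist_def)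
  have sub: "(\<lambda>a. hm A (b, a)) ` S \<subseteq> carrier (Hom Q X (ty A b))" if "b \<in> ob A" for b
    using S' that qcategoryD(2)[OF A] by fastforce
  have lst: "least ?D ?c (Upper ?D (repr A ` S))"
  proof (rule least_UpperI)
    fix r assume "r \<in> repr A ` S"
    then show "r \<sqsubseteq>\<^bsub>?D\<^esub> ?c"
      using X sub qcategoryD(1)[OF A]
      by (auto simp: Dist_def repr_def col_sup_apply intro!: Hom_sup_upper)
  next
    fix \<phi> assume "\<phi> \<in> Upper ?D (repr A ` S)"
    then have d: "distributor Q (star Q X) A \<phi>"
      and le_D: "\<And>r. r \<in> repr A ` S \<Longrightarrow> r \<sqsubseteq>\<^bsub>?D\<^esub> \<phi>"
      using reprs by (auto simp: Upper_def Dist_def)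
    have le: "hm A (b, a) \<sqsubseteq>\<^bsub>Hom Q X (ty A b)\<^esub> \<phi> (b, ())" if "a \<in> S" "b \<in> ob A" for a b
      using le_D[OF imageI[OF that(1)]] that(2) by (auto simp: Dist_def repr_def)
    have "\<phi> (b, ()) \<in> carrier (Hom Q X (ty A b))" if "b \<in> ob A" for b
      using distributorD(1)[OF d, of b "()"] that by simp
    then show "?c \<sqsubseteq>\<^bsub>?D\<^esub> \<phi>"
      using le X sub qcategoryD(1)[OF A] by (auto simp: Dist_def col_sup_apply Hom_sup_le_iff)
  qed (use reprs c in \<open>auto simp: Dist_def\<close>)
  \<comment> \<open>The library's supremum is a choice among least upper bounds. Two of them lie
    below each other, so by antisymmetry the choice can only be the column supremum.\<close>
  have "(SOME \<phi>. least ?D \<phi> (Upper ?D (repr A ` S))) = ?c"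
  proof (rule some_equality, rule lst)
    fix \<phi> assume l: "least ?D \<phi> (Upper ?D (repr A ` S))"
    have "distributor Q (star Q X) A \<phi>"
      using least_closed[OF l] by (simp add: Dist_def)
    then show "\<phi> = ?c"
      using c least_le[OF l least_mem[OF lst]] least_le[OF lst least_mem[OF l]]
      by (intro Dist_antisym[OF quantaloid_axioms qcategory_star[OF X] A])
  qed
  then show ?thesis
    by (simp add: sup_repr_def sup_def)
qed

text \<open>\<open>Haus_map\<close> and \<open>Haus_dist\<close> are restricted to conical
  presheaves; this membership allows them to be evaluated.\<close>

lemma sup_repr_in_Haus:
  assumes "X \<in> Obj Q" "qcategory Q A" "S \<subseteq> ob_of_type A X"
  shows "sup_repr Q A X S \<in> ob (Haus Q A)"
  using assms sup_repr_eq_col_sup[OF assms] distributor_col_sup_hm[OF assms]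
  by (auto simp: Haus_def Psh_def conical_def)


section \<open>Homs out of and composites with conical presheaves\<close>

text \<open>The Yoneda argument: composition distributes over the join of representables, which
  reduces the claim to a single representable; there the inequality for all \<open>c\<close> is
  equivalent to the one obtained from the identity at \<open>a\<close>.\<close>

lemma col_sup_comp_le_iff:
  assumes X: "X \<in> Obj Q" and Y: "Y \<in> Obj Q" and A: "qcategory Q A"
    and \<phi>: "distributor Q (star Q X) A \<phi>" and S: "S \<subseteq> ob_of_type A Y"
    and f: "f \<in> carrier (Hom Q X Y)"
  shows "(\<forall>c\<in>ob A. Cmp Q X Y (ty A c) (col_sup Q Y A (hm A) S (c, ())) f
            \<sqsubseteq>\<^bsub>Hom Q X (ty A c)\<^esub> \<phi> (c, ()))
      \<longleftrightarrow> (\<forall>a\<in>S. f \<sqsubseteq>\<^bsub>Hom Q X Y\<^esub> \<phi> (a, ()))"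
proof -
  have S': "a \<in> ob A" "ty A a = Y" if "a \<in> S" for a
    using S that by (auto simp: ob_of_type_def)
  have hmc: "hm A (c, a) \<in> carrier (Hom Q Y (ty A c))" if "c \<in> ob A" "a \<in> S" for c a
    using qcategoryD(2)[OF A that(1) S'(1)[OF that(2)]] S'(2)[OF that(2)] by simp
  have \<phi>c: "\<phi> (c, ()) \<in> carrier (Hom Q X (ty A c))" if "c \<in> ob A" for c
    using distributorD(1)[OF \<phi>, of c "()"] that by simp
  have "Cmp Q X Y (ty A c) (col_sup Q Y A (hm A) S (c, ())) f \<sqsubseteq>\<^bsub>Hom Q X (ty A c)\<^esub> \<phi> (c, ())
      \<longleftrightarrow> (\<forall>a\<in>S. Cmp Q X Y (ty A c) (hm A (c, a)) f \<sqsubseteq>\<^bsub>Hom Q X (ty A c)\<^esub> \<phi> (c, ()))"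
    if c: "c \<in> ob A" for c
  proof -
    have "Cmp Q X Y (ty A c) (col_sup Q Y A (hm A) S (c, ())) f
      = \<Squnion>\<^bsub>Hom Q X (ty A c)\<^esub> ((\<lambda>a. Cmp Q X Y (ty A c) (hm A (c, a)) f) ` S)"
      using X Y f c hmc qcategoryD(1)[OF A c]
      by (subst col_sup_apply[OF c], subst Cmp_sup_left) (auto simp: image_image)
    moreover have "(\<lambda>a. Cmp Q X Y (ty A c) (hm A (c, a)) f) ` S \<subseteq> carrier (Hom Q X (ty A c))"
      using X Y f c hmc qcategoryD(1)[OF A c] by (auto intro: Cmp_closed)
    ultimately show ?thesis
      using X \<phi>c c qcategoryD(1)[OF A c] by (simp add: Hom_sup_le_iff)
  qed
  moreover have "(\<forall>c\<in>ob A. Cmp Q X Y (ty A c) (hm A (c, a)) f \<sqsubseteq>\<^bsub>Hom Q X (ty A c)\<^esub> \<phi> (c, ()))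
      \<longleftrightarrow> f \<sqsubseteq>\<^bsub>Hom Q X Y\<^esub> \<phi> (a, ())" if a: "a \<in> S" for a
  proof
    assume "\<forall>c\<in>ob A. Cmp Q X Y (ty A c) (hm A (c, a)) f \<sqsubseteq>\<^bsub>Hom Q X (ty A c)\<^esub> \<phi> (c, ())"
    then have 1: "Cmp Q X Y Y (hm A (a, a)) f \<sqsubseteq>\<^bsub>Hom Q X Y\<^esub> \<phi> (a, ())"
      using S'[OF a] by auto
    \<comment> \<open>Since \<open>hm A (a, a)\<close> lies above the identity,
      \<open>f = 1 \<circ> f\<close> lies below \<open>hm A (a, a) \<circ> f\<close>.\<close>
    have 2: "f \<sqsubseteq>\<^bsub>Hom Q X Y\<^esub> Cmp Q X Y Y (hm A (a, a)) f"
      using Cmp_mono_left[OF X Y Y f Idt_closed[OF Y], of "hm A (a, a)"]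
        Cmp_Idt_left[OF X Y f] qcategoryD(2,3)[OF A] S'[OF a] by fastforce
    show "f \<sqsubseteq>\<^bsub>Hom Q X Y\<^esub> \<phi> (a, ())"
      using Hom_trans[OF X Y 2 1] f \<phi>c[of a] hmc[of a a] S'[OF a] a Cmp_closed[OF X Y Y f] by simp
  next
    assume le: "f \<sqsubseteq>\<^bsub>Hom Q X Y\<^esub> \<phi> (a, ())"
    \<comment> \<open>Conversely, compose the inequality with \<open>hm A (c, a)\<close> and use
      that \<open>A\<close> acts on the presheaf from the left.\<close>
    show "\<forall>c\<in>ob A. Cmp Q X Y (ty A c) (hm A (c, a)) f \<sqsubseteq>\<^bsub>Hom Q X (ty A c)\<^esub> \<phi> (c, ())"
    proof
      fix c assume c: "c \<in> ob A"
      note tyc = qcategoryD(1)[OF A c]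
      have \<phi>a: "\<phi> (a, ()) \<in> carrier (Hom Q X Y)" using \<phi>c[of a] S'[OF a] by simp
      show "Cmp Q X Y (ty A c) (hm A (c, a)) f \<sqsubseteq>\<^bsub>Hom Q X (ty A c)\<^esub> \<phi> (c, ())"
      proof (rule Hom_trans[OF X tyc])
        show "Cmp Q X Y (ty A c) (hm A (c, a)) f
            \<sqsubseteq>\<^bsub>Hom Q X (ty A c)\<^esub> Cmp Q X Y (ty A c) (hm A (c, a)) (\<phi> (a, ()))"
          by (rule Cmp_mono_right[OF X Y tyc hmc[OF c a] f \<phi>a le])
        show "Cmp Q X Y (ty A c) (hm A (c, a)) (\<phi> (a, ())) \<sqsubseteq>\<^bsub>Hom Q X (ty A c)\<^esub> \<phi> (c, ())"
          using distributorD(3)[OF \<phi> c S'(1)[OF a], of "()"] S'[OF a] by simp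
      qed (use X Y tyc f \<phi>a \<phi>c[OF c] hmc[OF c a] in \<open>auto intro: Cmp_closed\<close>)
    qed
  qed
  ultimately show ?thesis by blast
qed

section \<open>Liftings through a conical presheaf\<close>

lemma distributor_star_star_iff:
  assumes "X \<in> Obj Q" "Y \<in> Obj Q"
  shows "distributor Q (star Q X) (star Q Y) \<Theta> \<longleftrightarrow> \<Theta> ((), ()) \<in> carrier (Hom Q X Y)"
  using assms by (auto simp: distributor_star_iff[OF _ qcategory_star] extensional_def
      Cmp_Idt_left Hom_refl)

text \<open>Liftings are determined by their single entry, and the Yoneda criterion says that the
  admissible entries are exactly the lower bounds of the values of \<phi> on \<open>S\<close>. Only
  the first argument is conical: for claim (c), \<phi> will be a composite that need not be
  conical.\<close>

lemma hm_Psh_sup_repr: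
  assumes X: "X \<in> Obj Q" and Y: "Y \<in> Obj Q" and A: "qcategory Q A"
    and \<phi>: "distributor Q (star Q X) A \<phi>" and S: "S \<subseteq> ob_of_type A Y"
  shows "hm (Psh Q A) (sup_repr Q A Y S, (X, \<phi>)) = \<Sqinter>\<^bsub>Hom Q X Y\<^esub> ((\<lambda>a. \<phi> (a, ())) ` S)"
proof -
  let ?\<psi> = "col_sup Q Y A (hm A) S" and ?i = "\<Sqinter>\<^bsub>Hom Q X Y\<^esub> ((\<lambda>a. \<phi> (a, ())) ` S)"
  let ?L = "{\<Theta>. distributor Q (star Q X) (star Q Y) \<Theta> \<and>
    dist_comp Q (star Q X) (star Q Y) A ?\<psi> \<Theta> \<sqsubseteq>\<^bsub>Dist Q (star Q X) A\<^esub> \<phi>}"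
  have sub: "(\<lambda>a. \<phi> (a, ())) ` S \<subseteq> carrier (Hom Q X Y)"
    using distributorD(1)[OF \<phi>] S by (fastforce simp: ob_of_type_def)
  note i = Hom_inf_closed[OF X Y sub]
  have \<psi>: "?\<psi> (c, ()) \<in> carrier (Hom Q Y (ty A c))" if "c \<in> ob A" for c
    using distributorD(1)[OF distributor_col_sup_hm[OF Y A S], of c "()"] that by simp
  \<comment> \<open>The candidates for the lifting form the down-set of \<open>?i\<close>. For empty
    \<open>S\<close> the infimum is the top arrow, so no separate case arises.\<close>
  have L: "\<Theta> \<in> ?L \<longleftrightarrow> \<Theta> ((), ()) \<in> carrier (Hom Q X Y) \<and> \<Theta> ((), ()) \<sqsubseteq>\<^bsub>Hom Q X Y\<^esub> ?i" for \<Theta>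
  proof (cases "\<Theta> ((), ()) \<in> carrier (Hom Q X Y)")
    case True
    \<comment> \<open>The middle category has one object, so the supremum in the composite runs over
      a singleton.\<close>
    have "dist_comp Q (star Q X) (star Q Y) A ?\<psi> \<Theta> (c, ())
        = Cmp Q X Y (ty A c) (?\<psi> (c, ())) (\<Theta> ((), ()))" if "c \<in> ob A" for c
      using that X Y True \<psi> qcategoryD(1)[OF A]
      by (simp add: dist_comp_def Hom_sup_singleton Cmp_closed)
    then have "\<Theta> \<in> ?L \<longleftrightarrow> (\<forall>c\<in>ob A. Cmp Q X Y (ty A c) (?\<psi> (c, ())) (\<Theta> ((), ()))
        \<sqsubseteq>\<^bsub>Hom Q X (ty A c)\<^esub> \<phi> (c, ()))"
      using True by (simp add: Dist_def distributor_star_star_iff[OF X Y])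
    then show ?thesis
      using True col_sup_comp_le_iff[OF X Y A \<phi> S True] Hom_le_inf_iff[OF X Y sub True] by simp
  next
    case False
    then show ?thesis by (simp add: distributor_star_star_iff[OF X Y])
  qed
  \<comment> \<open>The equivalence supplies both the existence and the uniqueness needed by
    \<open>THE\<close> in \<open>lifting\<close>. A constant function can serve because the index
    set is the whole of \<open>unit \<times> unit\<close>, with nothing left to be
    \<open>undefined\<close>.\<close>
  have greatest: "greatest (Dist Q (star Q X) (star Q Y)) \<Theta> ?L \<longleftrightarrow> \<Theta> = (\<lambda>_. ?i)" for \<Theta>
  proof
    assume g: "greatest (Dist Q (star Q X) (star Q Y)) \<Theta> ?L"
    then have "\<Theta> \<in> ?L" by (simp add: greatest_def)
    moreover have "(\<lambda>_. ?i) \<in> ?L"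
      unfolding L using i X Y by (simp add: Hom_refl)
    with g have "?i \<sqsubseteq>\<^bsub>Hom Q X Y\<^esub> \<Theta> ((), ())"
      unfolding greatest_def by (auto simp: Dist_def)
    ultimately have "\<Theta> ((), ()) = ?i"
      using i by (intro Hom_antisym[OF X Y]) (auto simp: L[unfolded mem_Collect_eq])
    then show "\<Theta> = (\<lambda>_. ?i)" by auto
  next
    assume "\<Theta> = (\<lambda>_. ?i)"
    moreover have "(\<lambda>_. ?i) \<in> ?L"
      unfolding L using i X Y by (simp add: Hom_refl)
    moreover have "\<Theta> ((), ()) \<sqsubseteq>\<^bsub>Hom Q X Y\<^esub> ?i" if "\<Theta> \<in> ?L" for \<Theta>
      using that unfolding L by blast
    ultimately show "greatest (Dist Q (star Q X) (star Q Y)) \<Theta> ?L"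
      unfolding greatest_def by (auto simp: Dist_def)
  qed
  have "lifting Q (star Q X) (star Q Y) A ?\<psi> \<phi> = (\<lambda>_. ?i)"
    unfolding lifting_def greatest by simp
  then show ?thesis
    by (simp add: Psh_def sup_repr_eq_col_sup[OF Y A S])
qed

text \<open>Composing with a representable \<open>A(-, a)\<close> returns the column
  \<open>\<Phi>(-, a)\<close>: the right action of \<open>A\<close> bounds every term of the
  composite from above, and the term at \<open>c = a\<close> reaches this bound because of the
  identity. Joins over \<open>S\<close> are preserved by composition.\<close>

lemma dist_comp_sup_repr:
  assumes X: "X \<in> Obj Q" and A: "qcategory Q A" and B: "qcategory Q B"
    and \<Phi>: "distributor Q A B \<Phi>" and S: "S \<subseteq> ob_of_type A X"
  shows "dist_comp Q (star Q X) A B \<Phi> (snd (sup_repr Q A X S)) = col_sup Q X B \<Phi> S"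
proof (rule extensionalityI[of _ "ob B \<times> {()}"])
  show "dist_comp Q (star Q X) A B \<Phi> (snd (sup_repr Q A X S)) \<in> extensional (ob B \<times> {()})"
    "col_sup Q X B \<Phi> S \<in> extensional (ob B \<times> {()})"
    by (simp_all add: dist_comp_def col_sup_def)
  fix p assume "p \<in> ob B \<times> {()}"
  then obtain b where p: "p = (b, ())" and b: "b \<in> ob B" by auto
  note tyb = qcategoryD(1)[OF B b]
  let ?H = "Hom Q X (ty B b)" and ?r = "col_sup Q X B \<Phi> S (b, ())"
  let ?g = "\<lambda>c. Cmp Q X (ty A c) (ty B b) (\<Phi> (b, c)) (col_sup Q X A (hm A) S (c, ()))"
  have S': "a \<in> ob A" "ty A a = X" if "a \<in> S" for a
    using S that by (auto simp: ob_of_type_def)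
  have hmc: "hm A (c, a) \<in> carrier (Hom Q X (ty A c))" if "c \<in> ob A" "a \<in> S" for c a
    using qcategoryD(2)[OF A that(1) S'(1)[OF that(2)]] S'(2)[OF that(2)] by simp
  have \<Phi>c: "\<Phi> (b, a) \<in> carrier ?H" if "a \<in> S" for a
    using distributorD(1)[OF \<Phi> b S'(1)[OF that]] S'(2)[OF that] by simp
  have cc: "Cmp Q X (ty A c) (ty B b) (\<Phi> (b, c)) (hm A (c, a)) \<in> carrier ?H"
    if "c \<in> ob A" "a \<in> S" for c a
    using Cmp_closed[OF X _ tyb hmc[OF that] distributorD(1)[OF \<Phi> b that(1)]]
      qcategoryD(1)[OF A that(1)] by simp
  have g: "?g c = \<Squnion>\<^bsub>?H\<^esub> ((\<lambda>a. Cmp Q X (ty A c) (ty B b) (\<Phi> (b, c)) (hm A (c, a))) ` S)"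
    if c: "c \<in> ob A" for c
    using X tyb b c hmc distributorD(1)[OF \<Phi> b c] qcategoryD(1)[OF A c]
    by (subst col_sup_apply[OF c], subst Cmp_sup_right) (auto simp: image_image)
  have gc: "?g c \<in> carrier ?H" if "c \<in> ob A" for c
    unfolding g[OF that] using cc[OF that] by (auto intro!: Hom_sup_closed[OF X tyb])
  have rc: "?r \<in> carrier ?H"
    unfolding col_sup_apply[OF b] using \<Phi>c by (auto intro!: Hom_sup_closed[OF X tyb])
  have \<Phi>r: "\<Phi> (b, a) \<sqsubseteq>\<^bsub>?H\<^esub> ?r" if "a \<in> S" for a
    unfolding col_sup_apply[OF b] using \<Phi>c that by (auto intro!: Hom_sup_upper[OF X tyb])
  have "\<Squnion>\<^bsub>?H\<^esub> (?g ` ob A) = ?r"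
  proof (rule Hom_antisym[OF X tyb])
    show sc: "\<Squnion>\<^bsub>?H\<^esub> (?g ` ob A) \<in> carrier ?H"
      using gc by (auto intro!: Hom_sup_closed[OF X tyb])
    \<comment> \<open>Upper bound: distribute over the join defining the presheaf, then apply the
      right action of \<open>A\<close> on \<Phi> to each term.\<close>
    have "?g c \<sqsubseteq>\<^bsub>?H\<^esub> ?r" if c: "c \<in> ob A" for c
    proof -
      have "Cmp Q X (ty A c) (ty B b) (\<Phi> (b, c)) (hm A (c, a)) \<sqsubseteq>\<^bsub>?H\<^esub> ?r" if a: "a \<in> S" for a
        using Hom_trans[OF X tyb _ \<Phi>r[OF a] cc[OF c a] \<Phi>c[OF a] rc]
          distributorD(2)[OF \<Phi> b c S'(1)[OF a]] S'(2)[OF a] by simp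
      then show ?thesis
        unfolding g[OF c] using cc[OF c] rc by (subst Hom_sup_le_iff[OF X tyb]) auto
    qed
    then show "\<Squnion>\<^bsub>?H\<^esub> (?g ` ob A) \<sqsubseteq>\<^bsub>?H\<^esub> ?r"
      using gc rc by (subst Hom_sup_le_iff[OF X tyb]) auto
    \<comment> \<open>Lower bound through the term at \<open>c = a\<close>:
      \<open>\<Phi> (b, a)\<close> composed with the identity lies below its composite with
      \<open>hm A (a, a)\<close>, which is one member of the join \<open>?g a\<close>.\<close>
    have "\<Phi> (b, a) \<sqsubseteq>\<^bsub>?H\<^esub> \<Squnion>\<^bsub>?H\<^esub> (?g ` ob A)" if a: "a \<in> S" for a
    proof -
      note ob = S'(1)[OF a] and ty = S'(2)[OF a]
      let ?k = "Cmp Q X X (ty B b) (\<Phi> (b, a)) (hm A (a, a))"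
      have kc: "?k \<in> carrier ?H" using cc[OF ob a] ty by simp
      have 1: "\<Phi> (b, a) \<sqsubseteq>\<^bsub>?H\<^esub> ?k"
        using Cmp_mono_right[OF X X tyb \<Phi>c[OF a] Idt_closed[OF X], of "hm A (a, a)"]
          Cmp_Idt_right[OF X tyb \<Phi>c[OF a]] qcategoryD(2)[OF A ob ob] qcategoryD(3)[OF A ob] ty
        by simp
      have 2: "?k \<sqsubseteq>\<^bsub>?H\<^esub> ?g a"
        unfolding g[OF ob] using cc[OF ob] a ty by (intro Hom_sup_upper[OF X tyb]) auto
      have 3: "?g a \<sqsubseteq>\<^bsub>?H\<^esub> \<Squnion>\<^bsub>?H\<^esub> (?g ` ob A)"
        using gc ob by (intro Hom_sup_upper[OF X tyb]) auto
      show ?thesis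
        using Hom_trans[OF X tyb Hom_trans[OF X tyb 1 2 \<Phi>c[OF a] kc gc[OF ob]] 3
            \<Phi>c[OF a] gc[OF ob] sc] .
    qed
    then show "?r \<sqsubseteq>\<^bsub>?H\<^esub> \<Squnion>\<^bsub>?H\<^esub> (?g ` ob A)"
      unfolding col_sup_apply[OF b] using \<Phi>c sc by (subst Hom_sup_le_iff[OF X tyb]) auto
  qed (rule rc)
  then show "dist_comp Q (star Q X) A B \<Phi> (snd (sup_repr Q A X S)) p = col_sup Q X B \<Phi> S p"
    using b by (simp add: p dist_comp_def sup_repr_eq_col_sup[OF X A S])
qed

text \<open>The left action is composition in \<open>B\<close>. For the right action, the functor
  inequality first replaces \<open>hm A (a', a)\<close> by \<open>hm B (F a', F a)\<close>;
  composition in \<open>B\<close> then applies.\<close>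

lemma distributor_graph_dist:
  assumes A: "qcategory Q A" and B: "qcategory Q B" and F: "qfunctor Q A B F"
  shows "distributor Q A B (graph_dist A B F)"
proof -
  have Fob: "F a \<in> ob B" "ty B (F a) = ty A a" if "a \<in> ob A" for a
    using F that by (auto simp: qfunctor_def)
  have hmc: "hm B (b, F a) \<in> carrier (Hom Q (ty A a) (ty B b))" if "b \<in> ob B" "a \<in> ob A" for a b
    using qcategoryD(2)[OF B that(1) Fob(1)[OF that(2)]] Fob(2)[OF that(2)] by simp
  have right: "Cmp Q (ty A a) (ty A a') (ty B b) (hm B (b, F a')) (hm A (a', a))
      \<sqsubseteq>\<^bsub>Hom Q (ty A a) (ty B b)\<^esub> hm B (b, F a)"
    if b: "b \<in> ob B" and a': "a' \<in> ob A" and a: "a \<in> ob A" for a a' b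
  proof -
    note ty = qcategoryD(1)[OF A a] qcategoryD(1)[OF A a'] qcategoryD(1)[OF B b]
    have hF: "hm B (F a', F a) \<in> carrier (Hom Q (ty A a) (ty A a'))"
      using hmc[OF Fob(1)[OF a'] a] Fob(2)[OF a'] by simp
    have 1: "Cmp Q (ty A a) (ty A a') (ty B b) (hm B (b, F a')) (hm A (a', a))
      \<sqsubseteq>\<^bsub>Hom Q (ty A a) (ty B b)\<^esub>
        Cmp Q (ty A a) (ty A a') (ty B b) (hm B (b, F a')) (hm B (F a', F a))"
      using F a a' by (intro Cmp_mono_right ty hmc[OF b a'] hF qcategoryD(2)[OF A])
        (auto simp: qfunctor_def)
    have 2: "Cmp Q (ty A a) (ty A a') (ty B b) (hm B (b, F a')) (hm B (F a', F a))
      \<sqsubseteq>\<^bsub>Hom Q (ty A a) (ty B b)\<^esub> hm B (b, F a)"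
      using qcategoryD(4)[OF B b Fob(1)[OF a'] Fob(1)[OF a]] Fob(2)[OF a] Fob(2)[OF a'] by simp
    show ?thesis
      by (rule Hom_trans[OF ty(1,3) 1 2])
        (intro Cmp_closed ty hmc[OF b a'] hF qcategoryD(2)[OF A a' a] hmc[OF b a])+
  qed
  have "Cmp Q (ty A a) (ty B b') (ty B b) (hm B (b, b')) (hm B (b', F a))
      \<sqsubseteq>\<^bsub>Hom Q (ty A a) (ty B b)\<^esub> hm B (b, F a)"
    if "b \<in> ob B" "b' \<in> ob B" "a \<in> ob A" for a b b'
    using qcategoryD(4)[OF B that(1,2) Fob(1)[OF that(3)]] Fob(2)[OF that(3)] by simp
  with right hmc show ?thesis
    by (auto simp: distributor_def graph_dist_def PiE_iff)
qed

section \<open>The three formulas for the Hausdorff doctrine\<close>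

lemma hm_Haus_sup_repr:
  assumes "qcategory Q A" "X \<in> Obj Q" "Y \<in> Obj Q"
    and "S \<subseteq> ob_of_type A X" "S' \<subseteq> ob_of_type A Y"
  shows "hm (Haus Q A) (sup_repr Q A Y S', sup_repr Q A X S)
    = \<Sqinter>\<^bsub>Hom Q X Y\<^esub> ((\<lambda>a'. \<Squnion>\<^bsub>Hom Q X Y\<^esub> ((\<lambda>a. hm A (a', a)) ` S)) ` S')"
proof -
  \<comment> \<open>Members of \<open>S'\<close> have type \<open>Y\<close>, so each join is taken
    in the same lattice \<open>Hom Q X Y\<close> as the outer infimum.\<close>
  have "col_sup Q X A (hm A) S (a', ()) = \<Squnion>\<^bsub>Hom Q X Y\<^esub> ((\<lambda>a. hm A (a', a)) ` S)" if "a' \<in> S'" for a'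
    using that assms(5) by (auto simp: col_sup_apply ob_of_type_def)
  then show ?thesis
    using hm_Psh_sup_repr[OF assms(2,3,1) distributor_col_sup_hm assms(5)] assms
    by (simp add: Haus_def sup_repr_eq_col_sup[OF assms(2,1,4)] cong: image_cong_simp)
qed

lemma Haus_map_sup_repr:
  assumes "qcategory Q A" "qcategory Q B" "X \<in> Obj Q" "qfunctor Q A B F" "S \<subseteq> ob_of_type A X"
  shows "Haus_map Q A B F (sup_repr Q A X S) = sup_repr Q B X (F ` S)"
proof -
  have FS: "F ` S \<subseteq> ob_of_type B X"
    using assms(4,5) by (auto simp: ob_of_type_def qfunctor_def)
  \<comment> \<open>The column of the graph at an object \<open>a\<close> is the representable at
    \<open>F a\<close>; restriction to objects is harmless because \<open>S\<close> consists of
    objects of \<open>A\<close>.\<close>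
  have "(\<lambda>a. graph_dist A B F (b, a)) ` S = (\<lambda>b'. hm B (b, b')) ` F ` S" if "b \<in> ob B" for b
    unfolding image_image using assms(5) that
    by (intro image_cong) (auto simp: graph_dist_def ob_of_type_def)
  then have "col_sup Q X B (graph_dist A B F) S = col_sup Q X B (hm B) (F ` S)"
    unfolding col_sup_def by (intro restrict_ext) auto
  then show ?thesis
    using sup_repr_in_Haus[OF assms(3,1,5)] sup_repr_eq_col_sup[OF assms(3,1,5)]
      sup_repr_eq_col_sup[OF assms(3,2) FS]
      dist_comp_sup_repr[OF assms(3,1,2) distributor_graph_dist[OF assms(1,2,4)] assms(5)]
    by (simp add: Haus_map_def)
qed

lemma Haus_dist_sup_repr:
  assumes "qcategory Q A" "qcategory Q B" "X \<in> Obj Q" "Y \<in> Obj Q" "distributor Q A B \<Phi>"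
    and "S \<subseteq> ob_of_type A X" "T \<subseteq> ob_of_type B Y"
  shows "Haus_dist Q A B \<Phi> (sup_repr Q B Y T, sup_repr Q A X S)
    = \<Sqinter>\<^bsub>Hom Q X Y\<^esub> ((\<lambda>b. \<Squnion>\<^bsub>Hom Q X Y\<^esub> ((\<lambda>a. \<Phi> (b, a)) ` S)) ` T)"
proof -
  have "Haus_dist Q A B \<Phi> (sup_repr Q B Y T, sup_repr Q A X S)
      = hm (Psh Q B) (sup_repr Q B Y T, (X, col_sup Q X B \<Phi> S))"
    using sup_repr_in_Haus[OF assms(3,1,6)] sup_repr_in_Haus[OF assms(4,2,7)]
      dist_comp_sup_repr[OF assms(3,1,2,5,6)]
    by (simp add: Haus_dist_def sup_repr_eq_col_sup[OF assms(3,1,6)])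
  \<comment> \<open>The second presheaf is a join of columns of \<Phi>, so the hom formula is
    applied in its form for an arbitrary presheaf.\<close>
  also have "\<dots> = \<Sqinter>\<^bsub>Hom Q X Y\<^esub> ((\<lambda>b. col_sup Q X B \<Phi> S (b, ())) ` T)"
    using hm_Psh_sup_repr[OF assms(3,4,2) distributor_col_sup_distributor assms(7)] assms by simp
  also have "(\<lambda>b. col_sup Q X B \<Phi> S (b, ())) ` T = (\<lambda>b. \<Squnion>\<^bsub>Hom Q X Y\<^esub> ((\<lambda>a. \<Phi> (b, a)) ` S)) ` T"
    using assms(7) by (intro image_cong) (auto simp: col_sup_apply ob_of_type_def)
  finally show ?thesis .
qed

end

theorem mainTheorem4:
  fixes Q :: "('o, 'm) quantaloid"
    and \<A> :: "('o, 'm, 'a) qcat"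
    and \<B> :: "('o, 'm, 'b) qcat"
    and X Y :: 'o
  assumes "quantaloid Q"
    and "qcategory Q \<A>"
    and "qcategory Q \<B>"
    and "X \<in> Obj Q"
    and "Y \<in> Obj Q"
  shows
    "(\<forall>A A' \<phi> \<phi>'.
        A \<subseteq> ob_of_type \<A> X \<and> A' \<subseteq> ob_of_type \<A> Y \<and>
        \<phi> = sup_repr Q \<A> X A \<and> \<phi>' = sup_repr Q \<A> Y A' \<longrightarrow>
        hm (Haus Q \<A>) (\<phi>', \<phi>)
          = \<Sqinter>\<^bsub>Hom Q X Y\<^esub>
              ((\<lambda>a'. \<Squnion>\<^bsub>Hom Q X Y\<^esub> ((\<lambda>a. hm \<A> (a', a)) ` A)) ` A'))
     \<and>
     (\<forall>F A \<phi>.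
        qfunctor Q \<A> \<B> F \<and> A \<subseteq> ob_of_type \<A> X \<and> \<phi> = sup_repr Q \<A> X A \<longrightarrow>
        Haus_map Q \<A> \<B> F \<phi> = sup_repr Q \<B> X (F ` A))
     \<and>
     (\<forall>\<Phi> A B \<phi> \<psi>.
        distributor Q \<A> \<B> \<Phi> \<and>
        A \<subseteq> ob_of_type \<A> X \<and> \<phi> = sup_repr Q \<A> X A \<and>
        B \<subseteq> ob_of_type \<B> Y \<and> \<psi> = sup_repr Q \<B> Y B \<longrightarrow>
        Haus_dist Q \<A> \<B> \<Phi> (\<psi>, \<phi>)
          = \<Sqinter>\<^bsub>Hom Q X Y\<^esub>
              ((\<lambda>b. \<Squnion>\<^bsub>Hom Q X Y\<^esub> ((\<lambda>a. \<Phi> (b, a)) ` A)) ` B))"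
  using quantaloid.hm_Haus_sup_repr[OF assms(1,2,4,5)]
    quantaloid.Haus_map_sup_repr[OF assms(1-4)]
    quantaloid.Haus_dist_sup_repr[OF assms]
  by (intro conjI allI impI; elim conjE; hypsubst; simp only:)

end
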